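(* (Reduction formula.) Let $n\ge 1$, let $x_1,\ldots,x_n$ and $y=(y_1,y_2,\ldots)$ be independent commuting variables, and write $x^{(n)}=(x_1,\ldots,x_n)$ and $x^{(n-1)}=(x_1,\ldots,x_{n-1})$. Then for every partition $\lambda$, $$s_\lambda(x^{(n)},y)=\sum_{p=0}^\infty x_n^p\sum_{\mu\xrightarrow{p}\lambda}s_\mu(x^{(n-1)},y),$$ where the inner sum is over all partitions $\mu\subset\lambda$ such that $\lambda/\mu$ is a horizontal strip with $p$ boxes.
   Context: For a (finite or infinite) list of commuting variables $z=(z_1,z_2,\ldots)$, $h_r(z)$ denotes the $r$-th complete symmetric function, $\sum_{r\ge 0}h_r(z)t^r=\prod_i(1-z_it)^{-1}$, with $h_0=1$ and $h_r=0$ for $r<0$; set $h_\alpha=\prod_i h_{\alpha_i}$ for any integer sequence $\alpha$ with finitely many nonzero terms. For $i<j$ let $R_{ij}(\alpha)=(\alpha_1,\ldots,\alpha_i+1,\ldots,\alpha_j-1,\ldots)$, and for a monomial $R$ in the $R_{ij}$ let $R\,h_\alpha:=h_{R\alpha}$ (the operator acts on the index). The Schur function is $s_\alpha:=\prod_{i<j}(1-R_{ij})\,h_\alpha=\det(h_{\alpha_i+j-i})_{1\le i,j\le\ell}$, where $\ell$ is the largest index with $\alpha_\ell\neq 0$. The notation $s_\lambda(x^{(n)},y)$ means $s_\lambda$ evaluated in the combined list of variables $x_1,\ldots,x_n,y_1,y_2,\ldots$. For partitions, identified with Young diagrams, $\mu\subset\lambda$ means $\mu_i\le\lambda_i$ for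 all $i$. A skew diagram is a horizontal strip if it does not contain two boxes in the same column; $\mu\xrightarrow{p}\lambda$ means that $\mu\subset\lambda$ and $\lambda/\mu$ is a horizontal strip with $p$ boxes. *)

theory Defs
  imports
    "HOL-Library.Poly_Mapping"
    "HOL-Computational_Algebra.Formal_Power_Series"
begin

section \<open>Formal power series in arbitrarily many commuting variables\<close>

text \<open>
  A monomial is a finitely supported exponent vector. A monomial has only finitely many
  factorisations, so the convolution product below is a finite sum even if there are
  infinitely many variables.
\<close>

typedef 'v mfps = "UNIV :: (('v \<Rightarrow>\<^sub>0 nat) \<Rightarrow> int) set"
  morphisms mcoeff Abs_mfps ..

setup_lifting type_definition_mfps

lemma mfps_eqI: "(\<And>m. mcoeff f m = mcoeff g m) \<Longrightarrow> f = g"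
  by (metis ext mcoeff_inject)

definition splits :: "('v \<Rightarrow>\<^sub>0 nat) \<Rightarrow> (('v \<Rightarrow>\<^sub>0 nat) \<times> ('v \<Rightarrow>\<^sub>0 nat)) set" where
  "splits m = {(a, b). a + b = m}"

lemma finite_splits: "finite (splits m)"
proof -
  define N where "N = (\<Sum>k\<in>Poly_Mapping.keys m. Poly_Mapping.lookup m k)"
  define S where "S = {f. \<forall>x. (x \<in> Poly_Mapping.keys m \<longrightarrow> f x \<in> {..N}) \<and>
                             (x \<notin> Poly_Mapping.keys m \<longrightarrow> f x = 0)}"
  have fin: "finite S"
    unfolding S_def by (rule finite_set_of_finite_funs) simp_all
  have S: "Poly_Mapping.lookup a \<in> S" if m: "m = a + b" for a b
  proof -
    have le: "Poly_Mapping.lookup a x \<le> Poly_Mapping.lookup m x" for x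
      by (simp add: m lookup_add)
    have le2: "Poly_Mapping.lookup m x \<le> N" if "x \<in> Poly_Mapping.keys m" for x
      unfolding N_def by (rule member_le_sum[OF that]) simp_all
    have "Poly_Mapping.lookup a x \<in> {..N}" if "x \<in> Poly_Mapping.keys m" for x
      using order_trans[OF le le2[OF that]] by simp
    moreover have "Poly_Mapping.lookup a x = 0" if "x \<notin> Poly_Mapping.keys m" for x
      using le[of x] that by (simp add: in_keys_iff)
    ultimately show ?thesis
      unfolding S_def by blast
  qed
  have "finite {a. Poly_Mapping.lookup a \<in> S}"
    using finite_vimageI[OF fin, of Poly_Mapping.lookup]
    by (simp add: vimage_def inj_on_def)
  moreover have "splits m \<subseteq> {a. Poly_Mapping.lookup a \<in> S} \<times> {a. Poly_Mapping.lookup a \<in> S}"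
  proof (rule subrelI)
    fix a b assume "(a, b) \<in> splits m"
    then have "m = a + b" "m = b + a"
      by (simp_all add: splits_def add.commute)
    from this[THEN S] show
      "(a, b) \<in> {a. Poly_Mapping.lookup a \<in> S} \<times> {a. Poly_Mapping.lookup a \<in> S}"
      by simp
  qed
  ultimately show ?thesis
    by (meson finite_SigmaI finite_subset)
qed

instantiation mfps :: (type) comm_ring_1
begin

lift_definition zero_mfps :: "'a mfps" is "\<lambda>_. 0" .
lift_definition one_mfps :: "'a mfps" is "\<lambda>m. if m = 0 then 1 else 0" .
lift_definition plus_mfps :: "'a mfps \<Rightarrow> 'a mfps \<Rightarrow> 'a mfps" is "\<lambda>f g m. f m + g m" .
lift_definition minus_mfps :: "'a mfps \<Rightarrow> 'a mfps \<Rightarrow> 'a mfps" is "\<lambda>f g m. f m - g m" .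
lift_definition uminus_mfps :: "'a mfps \<Rightarrow> 'a mfps" is "\<lambda>f m. - f m" .
lift_definition times_mfps :: "'a mfps \<Rightarrow> 'a mfps \<Rightarrow> 'a mfps"
  is "\<lambda>f g m. \<Sum>(a, b)\<in>splits m. f a * g b" .

instance
proof
  fix f g h :: "'a mfps"
  show "f + g + h = f + (g + h)" "f + g = g + f" "0 + f = f" "- f + f = 0" "f - g = f + - g"
    by (transfer; simp add: algebra_simps)+
  show "(0 :: 'a mfps) \<noteq> 1"
    by transfer (auto simp: fun_eq_iff)
  show "(f + g) * h = f * h + g * h"
    by transfer (simp add: algebra_simps case_prod_unfold sum.distrib)
  show "f * g = g * f"
  proof (rule mfps_eqI)
    fix m
    show "mcoeff (f * g) m = mcoeff (g * f) m"
      unfolding times_mfps.rep_eq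
      by (rule sum.reindex_bij_witness[where i = prod.swap and j = prod.swap])
        (auto simp: splits_def add.commute)
  qed
  show "1 * f = f"
  proof (rule mfps_eqI)
    fix m
    have "(\<Sum>(a, b)\<in>splits m. mcoeff 1 a * mcoeff f b)
        = (\<Sum>(a, b)\<in>{(0, m)}. mcoeff 1 a * mcoeff f b)"
    proof (rule sum.mono_neutral_right[OF finite_splits])
      show "{(0, m)} \<subseteq> splits m"
        by (simp add: splits_def)
      show "\<forall>p\<in>splits m - {(0, m)}. (case p of (a, b) \<Rightarrow> mcoeff 1 a * mcoeff f b) = 0"
      proof
        fix p assume p: "p \<in> splits m - {(0, m)}"
        then have "fst p \<noteq> 0"
          by (cases p) (auto simp: splits_def)
        then show "(case p of (a, b) \<Rightarrow> mcoeff 1 a * mcoeff f b) = 0"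
          by (simp add: case_prod_unfold one_mfps.rep_eq)
      qed
    qed
    then show "mcoeff (1 * f) m = mcoeff f m"
      by (simp add: times_mfps.rep_eq one_mfps.rep_eq)
  qed
  show "f * g * h = f * (g * h)"
  proof (rule mfps_eqI)
    fix m
    have "mcoeff (f * g * h) m = (\<Sum>p\<in>splits m. \<Sum>q\<in>splits (fst p).
             mcoeff f (fst q) * mcoeff g (snd q) * mcoeff h (snd p))"
      by (simp add: times_mfps.rep_eq case_prod_unfold sum_distrib_right)
    also have "\<dots> = (\<Sum>(p, q)\<in>(SIGMA p:splits m. splits (fst p)).
             mcoeff f (fst q) * mcoeff g (snd q) * mcoeff h (snd p))"
      by (rule sum.Sigma) (simp_all add: finite_splits)
    also have "\<dots> = (\<Sum>(p, q)\<in>(SIGMA p:splits m. splits (snd p)).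
             mcoeff f (fst p) * (mcoeff g (fst q) * mcoeff h (snd q)))"
      by (rule sum.reindex_bij_witness[where
            i = "\<lambda>((a, d), (b, c)). ((a + b, c), (a, b))" and
            j = "\<lambda>((d, c), (a, b)). ((a, b + c), (b, c))"])
        (auto simp: splits_def add.assoc mult.assoc)
    also have "\<dots> = (\<Sum>p\<in>splits m. \<Sum>q\<in>splits (snd p).
             mcoeff f (fst p) * (mcoeff g (fst q) * mcoeff h (snd q)))"
      by (rule sum.Sigma[symmetric]) (simp_all add: finite_splits)
    also have "\<dots> = mcoeff (f * (g * h)) m"
      by (simp add: times_mfps.rep_eq case_prod_unfold sum_distrib_left)
    finally show "mcoeff (f * g * h) m = mcoeff (f * (g * h)) m" .
  qed
qed

end

lift_definition mvar :: "'v \<Rightarrow> 'v mfps" is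
  "\<lambda>v m. if m = Poly_Mapping.single v 1 then 1 else 0" .


section \<open>Complete symmetric functions\<close>

text \<open>
  The eventually constant value of a function along a filter: the limit used for formal
  (discrete) convergence.
\<close>

definition eventual_value :: "('a \<Rightarrow> 'b) \<Rightarrow> 'a filter \<Rightarrow> 'b" where
  "eventual_value f F = (THE c. \<forall>\<^sub>F x in F. f x = c)"

text \<open>
  The list \<open>z\<close> of variables is given by its (finite or infinite) set \<open>Z\<close> of members: the
  variables are distinct and their order is irrelevant. The power series in \<open>t\<close> are the
  univariate series (type \<open>fps\<close>) over the ring of power series in the variables.
\<close>

definition geom_factor :: "'v \<Rightarrow> 'v mfps fps" where  \<comment> \<open>\<open>(1 - v t)\<^sup>-\<^sup>1\<close>\<close>
  "geom_factor v = fps_right_inverse (1 - fps_const (mvar v) * fps_X) 1"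

text \<open>
  The product over all of \<open>Z\<close> is the limit, coefficient by coefficient, of the products over
  finite subsets of \<open>Z\<close>.
\<close>

definition hsym :: "'v set \<Rightarrow> int \<Rightarrow> 'v mfps" where
  "hsym Z r = (if r < 0 then 0 else
     Abs_mfps (\<lambda>m. eventual_value
       (\<lambda>F. mcoeff (fps_nth (\<Prod>v\<in>F. geom_factor v) (nat r)) m)
       (finite_subsets_at_top Z)))"


section \<open>Raising operators and Schur functions\<close>

text \<open>
  An integer sequence \<open>\<alpha>\<close> with finitely many nonzero terms is a finitely supported function,
  with \<open>\<alpha>\<^sub>i\<close> stored at position \<open>i - 1\<close>. Since \<open>h\<^sub>0 = 1\<close>, the product over all entries is a
  product over the support.
\<close>

type_synonym index = "nat \<Rightarrow>\<^sub>0 int"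

definition hprod :: "'v set \<Rightarrow> index \<Rightarrow> 'v mfps" where
  "hprod Z \<alpha> = (\<Prod>k\<in>Poly_Mapping.keys \<alpha>. hsym Z (Poly_Mapping.lookup \<alpha> k))"

text \<open>
  Raising operators act on indices and not on power series. Formal integer combinations of
  indices form the group ring of the additive group of indices, in which \<open>R\<^sub>i\<^sub>j\<close> is
  multiplication by the following element.
\<close>

definition raise_index :: "nat \<Rightarrow> nat \<Rightarrow> index \<Rightarrow> index" where
  "raise_index i j \<alpha> = \<alpha> + Poly_Mapping.single i 1 - Poly_Mapping.single j 1"

definition raise_op :: "nat \<Rightarrow> nat \<Rightarrow> index \<Rightarrow>\<^sub>0 int" where
  "raise_op i j = Poly_Mapping.single (raise_index i j 0) 1"

lemma raise_op_act:
  "raise_op i j * Poly_Mapping.single \<alpha> 1 = Poly_Mapping.single (raise_index i j \<alpha>) 1"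
  by (simp add: raise_op_def raise_index_def mult_single add_diff_eq add.commute)

definition hlin :: "'v set \<Rightarrow> (index \<Rightarrow>\<^sub>0 int) \<Rightarrow> 'v mfps" where
  "hlin Z c = (\<Sum>\<alpha>\<in>Poly_Mapping.keys c. of_int (Poly_Mapping.lookup c \<alpha>) * hprod Z \<alpha>)"

text \<open>
  The infinite product of the \<open>1 - R\<^sub>i\<^sub>j\<close> is again the limit over finite sets of pairs. The
  values stabilise: a monomial involving some \<open>R\<^sub>i\<^sub>j\<close> with \<open>\<alpha>\<^sub>k = 0\<close> for all \<open>k \<ge> j\<close> makes
  the last entry it changes negative, so that its contribution vanishes.
\<close>

definition schur :: "'v set \<Rightarrow> index \<Rightarrow> 'v mfps" where
  "schur Z \<alpha> = eventual_value
     (\<lambda>P. hlin Z ((\<Prod>(i, j)\<in>P. 1 - raise_op i j) * Poly_Mapping.single \<alpha> 1))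
     (finite_subsets_at_top {(i, j). i < j})"


section \<open>Partitions and horizontal strips\<close>

definition is_partition :: "index \<Rightarrow> bool" where
  "is_partition \<alpha> \<longleftrightarrow> (\<forall>i. 0 \<le> Poly_Mapping.lookup \<alpha> i) \<and>
     (\<forall>i j. i \<le> j \<longrightarrow> Poly_Mapping.lookup \<alpha> j \<le> Poly_Mapping.lookup \<alpha> i)"

definition diagram :: "index \<Rightarrow> (nat \<times> nat) set" where  \<comment> \<open>boxes as (row, column)\<close>
  "diagram \<alpha> = {(i, j). int j < Poly_Mapping.lookup \<alpha> i}"

definition contained :: "index \<Rightarrow> index \<Rightarrow> bool" where
  "contained \<mu> \<alpha> \<longleftrightarrow> (\<forall>i. Poly_Mapping.lookup \<mu> i \<le> Poly_Mapping.lookup \<alpha> i)"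

definition horizontal_strip :: "(nat \<times> nat) set \<Rightarrow> bool" where
  "horizontal_strip D \<longleftrightarrow> (\<forall>i i' j. (i, j) \<in> D \<longrightarrow> (i', j) \<in> D \<longrightarrow> i = i')"

definition strip_step :: "index \<Rightarrow> nat \<Rightarrow> index \<Rightarrow> bool" where
  "strip_step \<mu> p \<alpha> \<longleftrightarrow> contained \<mu> \<alpha> \<and> horizontal_strip (diagram \<alpha> - diagram \<mu>) \<and>
     card (diagram \<alpha> - diagram \<mu>) = p"


section \<open>The variables of the reduction formula\<close>

text \<open>The constructors are indexed from 1 as in \<open>x\<^sub>1, \<dots>, x\<^sub>n, y\<^sub>1, y\<^sub>2, \<dots>\<close>; \<open>X 0\<close> and
  \<open>Y 0\<close> are never used.\<close>

datatype xyvar = X nat | Y nat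

definition xy_vars :: "nat \<Rightarrow> xyvar set" where
  "xy_vars n = X ` {1..n} \<union> Y ` {1..}"

end

theory Submission
  imports Defs "HOL-Library.FuncSet" "HOL-Combinatorics.Transposition"
begin

text \<open>
  Write \<open>h\<^sub>r\<close> for the complete symmetric functions of the variables without \<open>x = x\<^sub>n\<close>, and
  \<open>H\<^sub>r\<close> for those of all variables. The generating function gives \<open>H\<^sub>r - x H\<^bsub>r-1\<^esub> = h\<^sub>r\<close>
  (\<open>hsym_insert\<close>), and the Schur function of \<open>\<lambda>\<close> in all variables is the determinant with
  rows \<open>H (\<lambda>\<^sub>k - k + j)\<close>, where \<open>k, j < l\<close> and \<open>\<lambda>\<close> has at most \<open>l\<close> nonzero parts
  (\<open>schur_eq_row_det\<close>).

  Subtract \<open>x\<close> to the power \<open>\<lambda>\<^sub>k - \<lambda>\<^bsub>k+1\<^esub> + 1\<close> times row \<open>k + 1\<close> from row \<open>k\<close>, for each \<open>k\<close>.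
  Telescoping the recurrence turns row \<open>k\<close> into the sum of \<open>x\<close> to the power \<open>\<lambda>\<^sub>k - r\<close> times
  \<open>h (r - k + j)\<close> over \<open>\<lambda>\<^bsub>k+1\<^esub> \<le> r \<le> \<lambda>\<^sub>k\<close> (\<open>row_det_row_operations\<close>). Expanding the
  determinant multilinearly chooses one \<open>r = \<mu>\<^sub>k\<close> in each row. The resulting sequences \<open>\<mu>\<close>
  are those interlacing \<open>\<lambda>\<close>, which are exactly the partitions for which \<open>\<lambda>/\<mu>\<close> is a
  horizontal strip (\<open>horizontal_strip_iff_interlacing\<close>). The exponents of \<open>x\<close> add up to the
  number of boxes of the strip, and the remaining determinant is the Schur function of \<open>\<mu>\<close>
  without \<open>x\<close>.

  The determinant calculus is derived from the raising operators themselves. Linearity in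
  each row is immediate; the vanishing for two equal adjacent rows comes from the symmetry of
  all factors but one under exchanging the two rows (\<open>raised_antisymmetric\<close>). That finitely
  many operators suffice follows since an operator \<open>R\<^sub>i\<^sub>j\<close> with \<open>j\<close> beyond the last part makes
  an entry negative (\<open>raised_hprod_stable\<close>).
\<close>

section \<open>Removing one variable from the complete symmetric functions\<close>

lemma eventual_value_eq:
  assumes "\<forall>\<^sub>F x in F. f x = c" and "F \<noteq> bot"
  shows "eventual_value f F = c"
  unfolding eventual_value_def
proof (rule the_equality)
  fix d assume "\<forall>\<^sub>F x in F. f x = d"
  with assms(1) have "\<forall>\<^sub>F x in F. c = d"
    by eventually_elim simp
  then show "d = c"
    using assms(2) by (simp add: eventually_const_iff)
qed (rule assms(1))

lemma geom_factor_inverse: "(1 - fps_const (mvar v) * fps_X) * geom_factor v = 1"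
  unfolding geom_factor_def by (rule fps_right_inverse) simp

definition hsym_finite :: "'v set \<Rightarrow> nat \<Rightarrow> 'v mfps" where
  "hsym_finite F r = fps_nth (\<Prod>v\<in>F. geom_factor v) r"

lemma hsym_finite_insert:
  assumes "finite F" "v \<notin> F"
  shows "hsym_finite (insert v F) r =
    hsym_finite F r + (if r = 0 then 0 else mvar v * hsym_finite (insert v F) (r - 1))"
proof -
  let ?G = "\<lambda>F. \<Prod>v\<in>F. geom_factor v"
  have "(1 - fps_const (mvar v) * fps_X) * ?G (insert v F) = ?G F"
    using assms by (simp only: prod.insert not_False_eq_True mult.assoc[symmetric] geom_factor_inverse mult_1_left)
  then have "?G (insert v F) - fps_const (mvar v) * (fps_X * ?G (insert v F)) = ?G F"
    by (simp only: left_diff_distrib mult_1_left mult.assoc)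
  then have "fps_nth (?G F) r =
      fps_nth (?G (insert v F) - fps_const (mvar v) * (fps_X * ?G (insert v F))) r"
    by (simp only:)
  also have "\<dots> = fps_nth (?G (insert v F)) r -
      mvar v * (if r = 0 then 0 else fps_nth (?G (insert v F)) (r - 1))"
    by (simp only: fps_sub_nth fps_mult_left_const_nth fps_X_mult_nth)
  finally have "fps_nth (?G (insert v F)) r = fps_nth (?G F) r +
      mvar v * (if r = 0 then 0 else fps_nth (?G (insert v F)) (r - 1))"
    by (simp only: diff_add_cancel)
  then show ?thesis
    unfolding hsym_finite_def by (cases "r = 0") simp_all
qed

lemma hsym_finite_0 [simp]: "hsym_finite F 0 = 1"
proof (induction F rule: infinite_finite_induct)
  case (insert v F)
  then show ?case by (simp add: hsym_finite_insert[where r = 0])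
qed (simp_all add: hsym_finite_def)

lemma mcoeff_mvar_mult_notin:
  assumes "v \<notin> Poly_Mapping.keys m"
  shows "mcoeff (mvar v * g) m = 0"
  unfolding times_mfps.rep_eq
proof (rule sum.neutral, safe)
  fix a b assume "(a, b) \<in> splits m"
  then have "Poly_Mapping.lookup a v = 0"
    using assms by (auto simp: splits_def lookup_add in_keys_iff)
  then show "mcoeff (mvar v) a * mcoeff g b = 0"
    by (auto simp: mvar.rep_eq)
qed

lemma mcoeff_mult_cong:
  assumes "\<And>b. Poly_Mapping.keys b \<subseteq> Poly_Mapping.keys m \<Longrightarrow> mcoeff g b = mcoeff g' b"
  shows "mcoeff (f * g) m = mcoeff (f * g') m"
  unfolding times_mfps.rep_eq
proof (rule sum.cong[OF refl], safe)
  fix a b assume "(a, b) \<in> splits m"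
  then have "Poly_Mapping.keys b \<subseteq> Poly_Mapping.keys m"
    by (auto simp: splits_def lookup_add in_keys_iff)
  then show "mcoeff f a * mcoeff g b = mcoeff f a * mcoeff g' b"
    using assms by simp
qed

text \<open>
  A coefficient sees only the variables of its monomial, because a variable added to \<open>F\<close>
  contributes multiples of itself. This makes the limit in the definition of \<open>hsym\<close> exist.
\<close>

lemma mcoeff_hsym_finite_restrict:
  assumes "finite F" "F' \<subseteq> F" "Poly_Mapping.keys m \<inter> F \<subseteq> F'"
  shows "mcoeff (hsym_finite F r) m = mcoeff (hsym_finite F' r) m"
proof -
  have step: "mcoeff (hsym_finite (F' \<union> D) r) m = mcoeff (hsym_finite F' r) m"
    if "finite D" "D \<inter> F' = {}" "Poly_Mapping.keys m \<inter> D = {}" for D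
    using that
  proof (induction D)
    case (insert v D)
    have "finite (F' \<union> D)" "v \<notin> F' \<union> D"
      using insert.hyps insert.prems assms finite_subset by auto
    from hsym_finite_insert[OF this, of r]
    have "mcoeff (hsym_finite (insert v (F' \<union> D)) r) m = mcoeff (hsym_finite (F' \<union> D) r) m"
      using insert.prems by (simp add: plus_mfps.rep_eq zero_mfps.rep_eq mcoeff_mvar_mult_notin)
    with insert show ?case
      by simp
  qed simp
  have "mcoeff (hsym_finite (F' \<union> (F - F')) r) m = mcoeff (hsym_finite F' r) m"
    by (rule step) (use assms in auto)
  then show ?thesis
    using assms(2) by (simp add: Un_absorb1)
qed

lemma mcoeff_hsym:
  assumes "finite F" "F \<subseteq> Z" "Poly_Mapping.keys m \<inter> Z \<subseteq> F"
  shows "mcoeff (hsym Z (int r)) m = mcoeff (hsym_finite F r) m"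
proof -
  have "eventual_value (\<lambda>F. mcoeff (hsym_finite F r) m) (finite_subsets_at_top Z) = mcoeff (hsym_finite F r) m"
  proof (rule eventual_value_eq)
    show "\<forall>\<^sub>F E in finite_subsets_at_top Z. mcoeff (hsym_finite E r) m = mcoeff (hsym_finite F r) m"
      unfolding eventually_finite_subsets_at_top
    proof (intro exI conjI allI impI)
      fix E assume "finite E \<and> F \<subseteq> E \<and> E \<subseteq> Z"
      then show "mcoeff (hsym_finite E r) m = mcoeff (hsym_finite F r) m"
        by (intro mcoeff_hsym_finite_restrict) (use assms in auto)
    qed (use assms in auto)
  qed simp
  then show ?thesis
    by (simp add: hsym_def Abs_mfps_inverse hsym_finite_def)
qed

lemma hsym_neg: "r < 0 \<Longrightarrow> hsym Z r = 0"
  by (simp add: hsym_def)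

lemma hsym_0 [simp]: "hsym Z 0 = 1"
proof (rule mfps_eqI)
  fix m
  show "mcoeff (hsym Z 0) m = mcoeff 1 m"
    using mcoeff_hsym[of "Poly_Mapping.keys m \<inter> Z" Z m 0] by simp
qed

lemma hsym_insert:
  fixes v :: "'v"
  assumes "v \<notin> Z"
  shows "hsym (insert v Z) r = hsym Z r + mvar v * hsym (insert v Z) (r - 1)"
proof (cases "r < 0")
  case False
  then obtain k where k: "r = int k"
    using zero_le_imp_eq_int by force
  show ?thesis
  proof (rule mfps_eqI)
    fix m :: "'v \<Rightarrow>\<^sub>0 nat"
    let ?F = "Poly_Mapping.keys m \<inter> Z"
    have F: "finite ?F" "v \<notin> ?F"
      using assms by auto
    have "mcoeff (hsym (insert v Z) r) m = mcoeff (hsym_finite (insert v ?F) k) m"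
      unfolding k by (rule mcoeff_hsym) auto
    also have "\<dots> = mcoeff (hsym_finite ?F k) m +
        mcoeff (if k = 0 then 0 else mvar v * hsym_finite (insert v ?F) (k - 1)) m"
      using hsym_finite_insert[OF F, of k] by (metis plus_mfps.rep_eq)
    also have "mcoeff (hsym_finite ?F k) m = mcoeff (hsym Z r) m"
      unfolding k by (rule mcoeff_hsym[symmetric]) auto
    also have "mcoeff (if k = 0 then 0 else mvar v * hsym_finite (insert v ?F) (k - 1)) m =
        mcoeff (mvar v * hsym (insert v Z) (r - 1)) m"
    proof (cases "k = 0")
      case True
      then show ?thesis by (simp add: k hsym_neg)
    next
      case False
      have "mcoeff (mvar v * hsym_finite (insert v ?F) (k - 1)) m =
          mcoeff (mvar v * hsym (insert v Z) (r - 1)) m"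
      proof (rule mcoeff_mult_cong)
        fix b :: "'v \<Rightarrow>\<^sub>0 nat" assume "Poly_Mapping.keys b \<subseteq> Poly_Mapping.keys m"
        then have "mcoeff (hsym (insert v Z) (int (k - 1))) b =
            mcoeff (hsym_finite (insert v ?F) (k - 1)) b"
          by (intro mcoeff_hsym) auto
        moreover have "int (k - 1) = r - 1"
          using False k by simp
        ultimately show "mcoeff (hsym_finite (insert v ?F) (k - 1)) b = mcoeff (hsym (insert v Z) (r - 1)) b"
          by simp
      qed
      with False show ?thesis by simp
    qed
    finally show "mcoeff (hsym (insert v Z) r) m =
        mcoeff (hsym Z r + mvar v * hsym (insert v Z) (r - 1)) m"
      by (simp add: plus_mfps.rep_eq)
  qed
qed (simp add: hsym_neg)

section \<open>Evaluating products of raising operators\<close>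

lemma lookup_raise_index:
  "Poly_Mapping.lookup (raise_index i j \<beta>) k =
     Poly_Mapping.lookup \<beta> k + (if k = i then 1 else 0) - (if k = j then 1 else 0)"
  by (simp add: raise_index_def lookup_add lookup_minus lookup_single when_def)

definition group_ring_eval :: "(index \<Rightarrow> 'r::comm_ring_1) \<Rightarrow> (index \<Rightarrow>\<^sub>0 int) \<Rightarrow> 'r" where
  "group_ring_eval f c = (\<Sum>\<alpha>\<in>Poly_Mapping.keys c. of_int (Poly_Mapping.lookup c \<alpha>) * f \<alpha>)"

lemma hlin_eq_group_ring_eval: "hlin Z = group_ring_eval (hprod Z)"
  by (simp add: fun_eq_iff hlin_def group_ring_eval_def)

lemma group_ring_eval_superset:
  assumes "finite S" "Poly_Mapping.keys c \<subseteq> S"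
  shows "group_ring_eval f c = (\<Sum>\<alpha>\<in>S. of_int (Poly_Mapping.lookup c \<alpha>) * f \<alpha>)"
  unfolding group_ring_eval_def
  by (rule sum.mono_neutral_left) (use assms in \<open>auto simp: in_keys_iff\<close>)

lemma group_ring_eval_diff:
  "group_ring_eval f (c - d) = group_ring_eval f c - group_ring_eval f d"
proof -
  let ?S = "Poly_Mapping.keys c \<union> Poly_Mapping.keys d"
  have "Poly_Mapping.keys (c - d) \<subseteq> ?S"
    by (auto simp: in_keys_iff lookup_minus)
  then show ?thesis
    by (simp add: group_ring_eval_superset[where S = ?S] lookup_minus left_diff_distrib
        sum_subtractf)
qed

lemma group_ring_eval_single [simp]: "group_ring_eval f (Poly_Mapping.single \<alpha> 1) = f \<alpha>"
  by (simp add: group_ring_eval_def)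

text \<open>The transpose of multiplication by \<open>1 - R\<^sub>i\<^sub>j\<close>, acting on functions of the index.\<close>

definition transposed_factor :: "nat \<times> nat \<Rightarrow> (index \<Rightarrow> 'r::comm_ring_1) \<Rightarrow> index \<Rightarrow> 'r" where
  "transposed_factor p f \<alpha> = f \<alpha> - f (raise_index (fst p) (snd p) \<alpha>)"

lemma group_ring_eval_raise:
  "group_ring_eval f ((1 - raise_op i j) * c) = group_ring_eval (transposed_factor (i, j) f) c"
proof -
  have "Poly_Mapping.keys c \<subseteq> UNIV" by simp
  then show ?thesis
  proof (induction c rule: frag_induction)
    case zero
    then show ?case by (simp add: group_ring_eval_def)
  next
    case (one \<alpha>)
    then show ?case
      by (simp add: left_diff_distrib raise_op_act group_ring_eval_diff transposed_factor_def)
  next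
    case (diff a b)
    then show ?case
      by (simp add: right_diff_distrib group_ring_eval_diff)
  qed
qed

text \<open>
  Because the factors can be moved one at a time from the group ring to the function \<open>f\<close>, the
  facts below follow by induction on \<open>P\<close> for all \<open>f\<close> at once, without computing in the
  group ring.
\<close>

definition raised :: "(nat \<times> nat) set \<Rightarrow> (index \<Rightarrow> 'r::comm_ring_1) \<Rightarrow> index \<Rightarrow> 'r" where
  "raised P f \<alpha> =
     group_ring_eval f ((\<Prod>(i, j)\<in>P. 1 - raise_op i j) * Poly_Mapping.single \<alpha> 1)"

lemma raised_empty [simp]: "raised {} f \<alpha> = f \<alpha>"
  by (simp add: raised_def)

lemma raised_insert:
  assumes "finite P" "p \<notin> P"
  shows "raised (insert p P) f = raised P (transposed_factor p f)"
proof (rule ext)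
  fix \<alpha>
  show "raised (insert p P) f \<alpha> = raised P (transposed_factor p f) \<alpha>"
    using assms by (cases p) (simp add: raised_def group_ring_eval_raise mult.assoc)
qed

lemma raised_cong:
  assumes "finite P" "\<alpha> \<in> I"
    and "\<And>i j \<beta>. (i, j) \<in> P \<Longrightarrow> \<beta> \<in> I \<Longrightarrow> raise_index i j \<beta> \<in> I"
    and "\<And>\<beta>. \<beta> \<in> I \<Longrightarrow> f \<beta> = g \<beta>"
  shows "raised P f \<alpha> = raised P g \<alpha>"
  using assms
proof (induction P arbitrary: f g)
  case (insert p P)
  have "raised P (transposed_factor p f) \<alpha> = raised P (transposed_factor p g) \<alpha>"
  proof (rule insert.IH)
    show "transposed_factor p f \<beta> = transposed_factor p g \<beta>" if "\<beta> \<in> I" for \<beta>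
      unfolding transposed_factor_def
      using insert.prems(2)[of "fst p" "snd p" \<beta>] insert.prems(3) that by simp
  qed (use insert.prems in auto)
  then show ?case
    by (simp add: raised_insert insert.hyps)
qed simp

lemma raised_zero: "raised P (\<lambda>_. 0) \<alpha> = 0"
  by (simp add: raised_def group_ring_eval_def)

lemma raised_diff: "raised P (\<lambda>\<beta>. f \<beta> - g \<beta>) \<alpha> = raised P f \<alpha> - raised P g \<alpha>"
  by (simp add: raised_def group_ring_eval_def right_diff_distrib sum_subtractf)

lemma raised_cmult: "raised P (\<lambda>\<beta>. c * f \<beta>) \<alpha> = c * raised P f \<alpha>"
  by (simp add: raised_def group_ring_eval_def sum_distrib_left mult.left_commute)

lemma raised_sum: "raised P (\<lambda>\<beta>. \<Sum>t\<in>T. f t \<beta>) \<alpha> = (\<Sum>t\<in>T. raised P (f t) \<alpha>)"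
  by (simp add: raised_def group_ring_eval_def sum_distrib_left sum.swap[of _ T])

lemma raised_shift:
  assumes "finite P"
  shows "raised P (\<lambda>\<beta>. f (\<beta> + \<gamma>)) \<alpha> = raised P f (\<alpha> + \<gamma>)"
  using assms
proof (induction P arbitrary: f)
  case (insert p P)
  have "transposed_factor p (\<lambda>\<beta>. f (\<beta> + \<gamma>)) = (\<lambda>\<beta>. transposed_factor p f (\<beta> + \<gamma>))"
    by (simp add: transposed_factor_def raise_index_def fun_eq_iff algebra_simps)
  then show ?case
    by (simp add: raised_insert insert)
qed simp

lemma raised_insert_diff:
  assumes "finite P" "p \<notin> P"
  shows "raised (insert p P) f \<alpha> =
    raised P f \<alpha> - raised P f (raise_index (fst p) (snd p) \<alpha>)"
proof -
  let ?R = "raise_index (fst p) (snd p)"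
  have R: "?R = (\<lambda>\<beta>. \<beta> + ?R 0)"
    by (simp add: fun_eq_iff raise_index_def algebra_simps)
  have "raised (insert p P) f \<alpha> = raised P (\<lambda>\<beta>. f \<beta> - f (?R \<beta>)) \<alpha>"
    using assms by (simp add: raised_insert transposed_factor_def[abs_def])
  also have "\<dots> = raised P f \<alpha> - raised P (\<lambda>\<beta>. f (?R \<beta>)) \<alpha>"
    by (rule raised_diff)
  also have "raised P (\<lambda>\<beta>. f (?R \<beta>)) \<alpha> = raised P f (?R \<alpha>)"
    using raised_shift[OF assms(1), of f "?R 0" \<alpha>] R by metis
  finally show ?thesis .
qed

text \<open>
  The operators in \<open>P\<close> never raise row \<open>k\<close>, so every index they reach from \<open>\<alpha>\<close> still has
  its \<open>k\<close>-th entry at most \<open>c\<close>.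
\<close>

lemma raised_vanish:
  assumes "finite P" "k \<notin> fst ` P" "Poly_Mapping.lookup \<alpha> k \<le> c"
    and "\<And>\<beta>. Poly_Mapping.lookup \<beta> k \<le> c \<Longrightarrow> f \<beta> = 0"
  shows "raised P f \<alpha> = 0"
proof -
  have "raised P f \<alpha> = raised P (\<lambda>_. 0) \<alpha>"
  proof (rule raised_cong[OF assms(1), where I = "{\<beta>. Poly_Mapping.lookup \<beta> k \<le> c}"])
    fix i j \<beta> assume "(i, j) \<in> P" "\<beta> \<in> {\<beta>. Poly_Mapping.lookup \<beta> k \<le> c}"
    moreover from \<open>(i, j) \<in> P\<close> have "i \<noteq> k"
      using assms(2) by force
    ultimately show "raise_index i j \<beta> \<in> {\<beta>. Poly_Mapping.lookup \<beta> k \<le> c}"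
      by (auto simp: lookup_raise_index)
  qed (use assms in auto)
  then show ?thesis
    by (simp add: raised_zero)
qed

section \<open>Antisymmetry in adjacent rows\<close>

definition swap_rows :: "nat \<Rightarrow> nat \<Rightarrow> index \<Rightarrow> index" where
  "swap_rows a b \<beta> = \<beta>
     + Poly_Mapping.single a (Poly_Mapping.lookup \<beta> b - Poly_Mapping.lookup \<beta> a)
     + Poly_Mapping.single b (Poly_Mapping.lookup \<beta> a - Poly_Mapping.lookup \<beta> b)"

lemma lookup_swap_rows [simp]:
  "Poly_Mapping.lookup (swap_rows a b \<beta>) k = Poly_Mapping.lookup \<beta> (transpose a b k)"
  by (simp add: swap_rows_def lookup_add lookup_single transpose_def when_def)

lemma swap_rows_raise:
  "swap_rows a b (raise_index (transpose a b i) (transpose a b j) \<beta>) =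
   raise_index i j (swap_rows a b \<beta>)"
proof (rule poly_mapping_eqI)
  fix k
  have "transpose a b k = transpose a b i \<longleftrightarrow> k = i" for i
    by (metis transpose_involutory)
  then show "Poly_Mapping.lookup (swap_rows a b
        (raise_index (transpose a b i) (transpose a b j) \<beta>)) k =
      Poly_Mapping.lookup (raise_index i j (swap_rows a b \<beta>)) k"
    by (simp add: lookup_raise_index)
qed

lemma raised_swap:
  assumes "finite P"
  shows "raised P f (swap_rows a b \<alpha>) =
    raised (map_prod (transpose a b) (transpose a b) ` P) (\<lambda>\<beta>. f (swap_rows a b \<beta>)) \<alpha>"
  using assms
proof (induction P arbitrary: f)
  case (insert p P)
  let ?\<tau> = "map_prod (transpose a b) (transpose a b)"
  have "inj ?\<tau>"
    by (intro prod.inj_map) (auto intro: inj_on_inverseI[of _ "transpose a b"])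
  then have "?\<tau> p \<notin> ?\<tau> ` P"
    using insert.hyps by (simp add: inj_image_mem_iff)
  moreover have "transposed_factor (?\<tau> p) (\<lambda>\<beta>. f (swap_rows a b \<beta>)) =
      (\<lambda>\<beta>. transposed_factor p f (swap_rows a b \<beta>))"
    by (simp add: transposed_factor_def swap_rows_raise fun_eq_iff)
  ultimately show ?case
    by (simp add: raised_insert insert)
qed simp

definition pairs_below :: "nat \<Rightarrow> (nat \<times> nat) set" where
  "pairs_below l = {(i, j). i < j \<and> j < l}"

lemma finite_pairs_below [simp]: "finite (pairs_below l)"
  by (rule finite_subset[of _ "{..<l} \<times> {..<l}"]) (auto simp: pairs_below_def)

text \<open>
  Exchanging the rows \<open>k\<close> and \<open>k + 1\<close> permutes all factors except \<open>1 - R\<^bsub>k,k+1\<^esub>\<close>. When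
  \<open>\<alpha>\<^bsub>k+1\<^esub> = \<alpha>\<^sub>k + 1\<close>, the operator \<open>R\<^bsub>k,k+1\<^esub>\<close> acts on \<open>\<alpha>\<close> as this exchange, which \<open>f\<close>
  does not see, so that the two terms of the exceptional factor cancel.
\<close>

lemma raised_antisymmetric:
  assumes "Suc k < l"
    and sym: "\<And>\<beta>. f (swap_rows k (Suc k) \<beta>) = f \<beta>"
    and \<alpha>: "Poly_Mapping.lookup \<alpha> (Suc k) = Poly_Mapping.lookup \<alpha> k + 1"
  shows "raised (pairs_below l) f \<alpha> = 0"
proof -
  let ?\<tau> = "transpose k (Suc k)"
  define Q where "Q = pairs_below l - {(k, Suc k)}"
  have "finite Q"
    by (simp add: Q_def)
  have \<tau>Q: "map_prod ?\<tau> ?\<tau> ` Q \<subseteq> Q"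
    using assms(1) by (auto simp: Q_def pairs_below_def transpose_def split: if_splits)
  moreover have "map_prod ?\<tau> ?\<tau> ` map_prod ?\<tau> ?\<tau> ` Q = Q"
    by (simp add: image_image map_prod_def case_prod_unfold)
  ultimately have Q: "map_prod ?\<tau> ?\<tau> ` Q = Q"
    by (metis image_mono subset_antisym)
  have \<alpha>': "raise_index k (Suc k) \<alpha> = swap_rows k (Suc k) \<alpha>"
    by (rule poly_mapping_eqI)
      (use \<alpha> in \<open>simp add: lookup_raise_index transpose_def\<close>)
  have "pairs_below l = insert (k, Suc k) Q"
    using assms(1) by (auto simp: Q_def pairs_below_def)
  then have "raised (pairs_below l) f \<alpha> =
      raised Q f \<alpha> - raised Q f (raise_index k (Suc k) \<alpha>)"
    using raised_insert_diff[OF \<open>finite Q\<close>, of "(k, Suc k)"] by (simp add: Q_def)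
  also have "raised Q f (raise_index k (Suc k) \<alpha>) = raised Q f \<alpha>"
    unfolding \<alpha>' raised_swap[OF \<open>finite Q\<close>] by (simp add: Q sym)
  finally show ?thesis by simp
qed

section \<open>Schur functions as determinants\<close>

lemma hprod_neg:
  assumes "Poly_Mapping.lookup \<beta> k < 0"
  shows "hprod Z \<beta> = 0"
  unfolding hprod_def
proof (rule prod_zero)
  show "\<exists>k\<in>Poly_Mapping.keys \<beta>. hsym Z (Poly_Mapping.lookup \<beta> k) = 0"
    using assms by (intro bexI[of _ k]) (auto simp: hsym_neg in_keys_iff)
qed simp

text \<open>
  The pair \<open>(i, j)\<close> of \<open>D\<close> with the largest \<open>j\<close> can be dropped: the term of \<open>1 - R\<^sub>i\<^sub>j\<close> that
  contains \<open>R\<^sub>i\<^sub>j\<close> makes row \<open>j\<close> negative, and no remaining operator \<open>R\<^sub>j\<^sub>m\<close> can raise it again.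
\<close>

lemma raised_hprod_stable:
  assumes \<alpha>: "\<And>k. l \<le> k \<Longrightarrow> Poly_Mapping.lookup \<alpha> k = 0"
    and "finite D" "D \<subseteq> {(i, j). i < j \<and> l \<le> j}"
  shows "raised (pairs_below l \<union> D) (hprod Z) \<alpha> = raised (pairs_below l) (hprod Z) \<alpha>"
  using assms(2,3)
proof (induction D rule: finite_psubset_induct)
  case (psubset D)
  show ?case
  proof (cases "D = {}")
    case False
    have "Max (snd ` D) \<in> snd ` D"
      using False psubset.hyps by simp
    then obtain i j where ij: "(i, j) \<in> D" and j: "j = Max (snd ` D)"
      by auto
    have max: "snd q \<le> j" if "q \<in> D" for q
      using that psubset.hyps by (simp add: j)
    from ij psubset.prems have "i < j" "l \<le> j"
      by auto
    let ?P = "pairs_below l \<union> (D - {(i, j)})"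
    have fin: "finite ?P"
      using psubset.hyps by simp
    have notin: "(i, j) \<notin> ?P"
      using \<open>l \<le> j\<close> by (auto simp: pairs_below_def)
    have "pairs_below l \<union> D = insert (i, j) ?P"
      using ij by auto
    then have "raised (pairs_below l \<union> D) (hprod Z) \<alpha> =
        raised ?P (hprod Z) \<alpha> - raised ?P (hprod Z) (raise_index i j \<alpha>)"
      by (simp only: raised_insert_diff[OF fin notin] fst_conv snd_conv)
    also have "raised ?P (hprod Z) (raise_index i j \<alpha>) = 0"
    proof (rule raised_vanish[OF fin, where k = j and c = "-1"])
      show "j \<notin> fst ` ?P"
        using max psubset.prems \<open>l \<le> j\<close> by (force simp: pairs_below_def)
      show "Poly_Mapping.lookup (raise_index i j \<alpha>) j \<le> -1"
        using \<alpha>[OF \<open>l \<le> j\<close>] \<open>i < j\<close> by (simp add: lookup_raise_index)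
    qed (auto intro: hprod_neg[of _ j])
    also have "raised ?P (hprod Z) \<alpha> = raised (pairs_below l) (hprod Z) \<alpha>"
      by (rule psubset.IH) (use ij psubset.prems in auto)
    finally show ?thesis by simp
  qed simp
qed

lemma schur_eq_raised:
  assumes "\<And>k. l \<le> k \<Longrightarrow> Poly_Mapping.lookup \<alpha> k = 0"
  shows "schur Z \<alpha> = raised (pairs_below l) (hprod Z) \<alpha>"
proof -
  have "\<forall>\<^sub>F P in finite_subsets_at_top {(i, j). i < j}.
      raised P (hprod Z) \<alpha> = raised (pairs_below l) (hprod Z) \<alpha>"
    unfolding eventually_finite_subsets_at_top
  proof (intro exI[of _ "pairs_below l"] conjI allI impI)
    fix P :: "(nat \<times> nat) set"
    assume P: "finite P \<and> pairs_below l \<subseteq> P \<and> P \<subseteq> {(i, j). i < j}"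
    then have "P = pairs_below l \<union> (P - pairs_below l)"
      by auto
    moreover have "raised (pairs_below l \<union> (P - pairs_below l)) (hprod Z) \<alpha> =
        raised (pairs_below l) (hprod Z) \<alpha>"
      by (rule raised_hprod_stable) (use assms P in \<open>auto simp: pairs_below_def\<close>)
    ultimately show "raised P (hprod Z) \<alpha> = raised (pairs_below l) (hprod Z) \<alpha>"
      by simp
  qed (simp, auto simp: pairs_below_def)
  from eventual_value_eq[OF this] show ?thesis
    by (simp add: schur_def hlin_eq_group_ring_eval raised_def)
qed

definition row_prod :: "nat \<Rightarrow> (nat \<Rightarrow> int \<Rightarrow> 'r::comm_ring_1) \<Rightarrow> index \<Rightarrow> 'r" where
  "row_prod l \<psi> \<beta> = (\<Prod>k<l. \<psi> k (Poly_Mapping.lookup \<beta> k))"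

text \<open>
  This is the determinant of the matrix with entries \<open>\<psi> k (j - k)\<close>: the product of the
  \<open>1 - R\<^sub>i\<^sub>j\<close> is the Vandermonde product, whose expansion is the alternating sum over
  permutations \<open>\<pi>\<close> of the shifts of row \<open>k\<close> by \<open>\<pi> k - k\<close>. The row calculus below is
  obtained directly from the raising operators, without that expansion.
\<close>

definition row_det :: "nat \<Rightarrow> (nat \<Rightarrow> int \<Rightarrow> 'r::comm_ring_1) \<Rightarrow> 'r" where
  "row_det l \<psi> = raised (pairs_below l) (row_prod l \<psi>) 0"

lemma schur_eq_row_det:
  assumes \<alpha>: "\<And>k. l \<le> k \<Longrightarrow> Poly_Mapping.lookup \<alpha> k = 0"
  shows "schur Z \<alpha> = row_det l (\<lambda>k b. hsym Z (Poly_Mapping.lookup \<alpha> k + b))"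
proof -
  have "schur Z \<alpha> = raised (pairs_below l) (hprod Z) \<alpha>"
    by (rule schur_eq_raised) (rule \<alpha>)
  also have "\<dots> = raised (pairs_below l) (row_prod l (\<lambda>_. hsym Z)) \<alpha>"
  proof (rule raised_cong[OF finite_pairs_below, where I = "{\<beta>. \<forall>k\<ge>l. Poly_Mapping.lookup \<beta> k = 0}"])
    fix \<beta> :: index assume "\<beta> \<in> {\<beta>. \<forall>k\<ge>l. Poly_Mapping.lookup \<beta> k = 0}"
    then have "Poly_Mapping.keys \<beta> \<subseteq> {..<l}"
      by (auto simp: in_keys_iff not_le[symmetric])
    then show "hprod Z \<beta> = row_prod l (\<lambda>_. hsym Z) \<beta>"
      unfolding hprod_def row_prod_def
      by (intro prod.mono_neutral_left) (auto simp: in_keys_iff)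
  qed (use \<alpha> in \<open>auto simp: pairs_below_def lookup_raise_index\<close>)
  also have "\<dots> = raised (pairs_below l) (\<lambda>\<beta>. row_prod l (\<lambda>_. hsym Z) (\<beta> + \<alpha>)) 0"
    by (simp add: raised_shift)
  also have "(\<lambda>\<beta>. row_prod l (\<lambda>_. hsym Z) (\<beta> + \<alpha>)) =
      row_prod l (\<lambda>k b. hsym Z (Poly_Mapping.lookup \<alpha> k + b))"
    by (simp add: row_prod_def lookup_add add.commute fun_eq_iff)
  finally show ?thesis
    by (simp add: row_det_def)
qed

lemma row_det_cong:
  assumes "\<And>k. k < l \<Longrightarrow> \<psi> k = \<phi> k"
  shows "row_det l \<psi> = row_det l \<phi>"
proof -
  have "row_prod l \<psi> = row_prod l \<phi>"
    using assms by (simp add: row_prod_def fun_eq_iff)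
  then show ?thesis by (simp add: row_det_def)
qed

lemma row_prod_update:
  assumes "k < l"
  shows "row_prod l (\<psi>(k := f)) \<beta> =
    f (Poly_Mapping.lookup \<beta> k) * (\<Prod>i\<in>{..<l} - {k}. \<psi> i (Poly_Mapping.lookup \<beta> i))"
proof -
  have "row_prod l (\<psi>(k := f)) \<beta> = f (Poly_Mapping.lookup \<beta> k) *
      (\<Prod>i\<in>{..<l} - {k}. (\<psi>(k := f)) i (Poly_Mapping.lookup \<beta> i))"
    unfolding row_prod_def using assms by (subst prod.remove[of _ k]) auto
  also have "(\<Prod>i\<in>{..<l} - {k}. (\<psi>(k := f)) i (Poly_Mapping.lookup \<beta> i)) =
      (\<Prod>i\<in>{..<l} - {k}. \<psi> i (Poly_Mapping.lookup \<beta> i))"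
    by (rule prod.cong) auto
  finally show ?thesis .
qed

lemma row_det_linear:
  assumes "k < l"
  shows "row_det l (\<psi>(k := \<lambda>b. f b - c * g b)) =
    row_det l (\<psi>(k := f)) - c * row_det l (\<psi>(k := g))"
proof -
  have "row_prod l (\<psi>(k := \<lambda>b. f b - c * g b)) =
      (\<lambda>\<beta>. row_prod l (\<psi>(k := f)) \<beta> - c * row_prod l (\<psi>(k := g)) \<beta>)"
    using assms by (simp add: fun_eq_iff row_prod_update algebra_simps)
  then show ?thesis
    by (simp add: row_det_def raised_diff raised_cmult)
qed

text \<open>
  In the matrix \<open>\<psi> k (j - k)\<close> the hypothesis says that rows \<open>k\<close> and \<open>Suc k\<close> coincide; the
  shift by one is the offset between adjacent rows.
\<close>

lemma row_det_equal_rows: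
  assumes "Suc k < l" and rows: "\<And>b. \<psi> k b = \<psi> (Suc k) (b - 1)"
  shows "row_det l \<psi> = 0"
proof -
  let ?\<psi> = "\<psi>(Suc k := \<psi> k)" and ?\<tau> = "transpose k (Suc k)"
  (* moving the offset into the index makes the two row functions literally equal *)
  have "row_prod l \<psi> = (\<lambda>\<beta>. row_prod l ?\<psi> (\<beta> + Poly_Mapping.single (Suc k) 1))"
    unfolding row_prod_def fun_eq_iff
    by (intro allI prod.cong) (auto simp: lookup_add lookup_single when_def rows)
  then have "row_det l \<psi> = raised (pairs_below l) (row_prod l ?\<psi>) (Poly_Mapping.single (Suc k) 1)"
    by (simp add: row_det_def raised_shift)
  also have "\<dots> = 0"
  proof (rule raised_antisymmetric[OF assms(1)])
    fix \<beta>
    show "row_prod l ?\<psi> (swap_rows k (Suc k) \<beta>) = row_prod l ?\<psi> \<beta>"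
      unfolding row_prod_def
      by (rule prod.reindex_bij_witness[of _ ?\<tau> ?\<tau>])
        (use assms(1) in \<open>auto simp: transpose_def\<close>)
  qed (simp add: lookup_single)
  finally show ?thesis .
qed

text \<open>The last row is never raised, so only its values at nonpositive arguments enter.\<close>

lemma row_det_last_row:
  assumes "\<And>b. b \<le> 0 \<Longrightarrow> \<psi> k b = 0"
  shows "row_det (Suc k) \<psi> = 0"
  unfolding row_det_def
proof (rule raised_vanish[where k = k and c = 0])
  fix \<beta> :: index assume "Poly_Mapping.lookup \<beta> k \<le> 0"
  then show "row_prod (Suc k) \<psi> \<beta> = 0"
    by (simp add: row_prod_def assms)
qed (simp, auto simp: pairs_below_def)

lemma row_det_sum:
  assumes "\<And>k. k < l \<Longrightarrow> finite (B k)"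
  shows "row_det l (\<lambda>k b. \<Sum>r\<in>B k. w k r * g (r + b)) =
    (\<Sum>\<rho>\<in>PiE {..<l} B. (\<Prod>k<l. w k (\<rho> k)) * row_det l (\<lambda>k b. g (\<rho> k + b)))"
proof -
  have "row_prod l (\<lambda>k b. \<Sum>r\<in>B k. w k r * g (r + b)) =
      (\<lambda>\<beta>. \<Sum>\<rho>\<in>PiE {..<l} B. (\<Prod>k<l. w k (\<rho> k)) * row_prod l (\<lambda>k b. g (\<rho> k + b)) \<beta>)"
  proof (rule ext)
    fix \<beta>
    have "row_prod l (\<lambda>k b. \<Sum>r\<in>B k. w k r * g (r + b)) \<beta> =
        (\<Sum>\<rho>\<in>PiE {..<l} B. \<Prod>k<l. w k (\<rho> k) * g (\<rho> k + Poly_Mapping.lookup \<beta> k))"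
      unfolding row_prod_def by (rule prod_sum_PiE) (simp_all add: assms)
    then show "row_prod l (\<lambda>k b. \<Sum>r\<in>B k. w k r * g (r + b)) \<beta> =
        (\<Sum>\<rho>\<in>PiE {..<l} B. (\<Prod>k<l. w k (\<rho> k)) * row_prod l (\<lambda>k b. g (\<rho> k + b)) \<beta>)"
      by (simp add: row_prod_def prod.distrib)
  qed
  then show ?thesis
    by (simp add: row_det_def raised_sum raised_cmult)
qed

section \<open>Row operations removing a variable\<close>

text \<open>
  Iterating \<open>H r = h r + x H (r - 1)\<close> from \<open>v\<close> down to \<open>u\<close>. With \<open>v\<close> and \<open>u\<close> consecutive
  parts of a partition, the right-hand side is a row minus a multiple of the next row.
\<close>

lemma telescope_rows:
  fixes H h :: "int \<Rightarrow> 'r::comm_ring_1"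
  assumes "\<And>r. H r = h r + x * H (r - 1)" and "u \<le> v"
  shows "(\<Sum>r\<in>{u..v}. x ^ nat (v - r) * h (r + b)) =
    H (v + b) - x ^ nat (v - u + 1) * H (u - 1 + b)"
  using assms(2)
proof (induction v rule: int_ge_induct)
  case base
  show ?case using assms(1)[of "u + b"] by (simp add: algebra_simps)
next
  case (step v)
  have "{u..v + 1} = insert (v + 1) {u..v}"
    using step.hyps by auto
  then have "(\<Sum>r\<in>{u..v + 1}. x ^ nat (v + 1 - r) * h (r + b)) =
      h (v + 1 + b) + (\<Sum>r\<in>{u..v}. x ^ nat (v + 1 - r) * h (r + b))"
    by simp
  also have "(\<Sum>r\<in>{u..v}. x ^ nat (v + 1 - r) * h (r + b)) =
      x * (\<Sum>r\<in>{u..v}. x ^ nat (v - r) * h (r + b))"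
    unfolding sum_distrib_left
  proof (rule sum.cong[OF refl])
    fix r assume "r \<in> {u..v}"
    then have "nat (v + 1 - r) = Suc (nat (v - r))"
      by auto
    then show "x ^ nat (v + 1 - r) * h (r + b) = x * (x ^ nat (v - r) * h (r + b))"
      by (simp add: mult.assoc)
  qed
  also have "\<dots> = x * (H (v + b) - x ^ nat (v - u + 1) * H (u - 1 + b))"
    by (simp only: step.IH)
  also have "h (v + 1 + b) + \<dots> = H (v + 1 + b) - x * x ^ nat (v - u + 1) * H (u - 1 + b)"
    using assms(1)[of "v + 1 + b"] by (simp add: algebra_simps)
  also have "x * x ^ nat (v - u + 1) = x ^ nat (v + 1 - u + 1)"
  proof -
    have "nat (v + 1 - u + 1) = Suc (nat (v - u + 1))"
      using step.hyps by auto
    then show ?thesis by simp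
  qed
  finally show ?case .
qed

text \<open>
  The rows are treated from the top down, so that each one is corrected by a multiple of the
  still unmodified next row. What is subtracted from the last row is a multiple of
  \<open>H (b - 1)\<close>, which is zero wherever the last row is evaluated.
\<close>

lemma row_det_row_operations:
  fixes H h :: "int \<Rightarrow> 'r::comm_ring_1"
  assumes rec: "\<And>r. H r = h r + x * H (r - 1)" and neg: "\<And>r. r < 0 \<Longrightarrow> H r = 0"
    and anti: "\<And>k. a (Suc k) \<le> a k" and "a l = (0 :: int)"
  shows "row_det l (\<lambda>k b. H (a k + b)) =
    row_det l (\<lambda>k b. \<Sum>r\<in>{a (Suc k)..a k}. x ^ nat (a k - r) * h (r + b))"
proof -
  define \<psi> where "\<psi> = (\<lambda>k b. H (a k + b))"
  define \<psi>' where "\<psi>' = (\<lambda>k b. \<Sum>r\<in>{a (Suc k)..a k}. x ^ nat (a k - r) * h (r + b))"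
  define \<phi> where "\<phi> m = (\<lambda>k. if k < m then \<psi>' k else \<psi> k)" for m
  have "row_det l (\<phi> m) = row_det l \<psi>" if "m \<le> l" for m
    using that
  proof (induction m)
    case 0
    then show ?case by (simp add: \<phi>_def)
  next
    case (Suc m)
    define c where "c = x ^ nat (a m - a (Suc m) + 1)"
    define g where "g = (\<lambda>b. H (a (Suc m) - 1 + b))"
    have "\<psi>' m = (\<lambda>b. \<psi> m b - c * g b)"
      by (simp add: \<psi>_def \<psi>'_def c_def g_def telescope_rows[where H = H and h = h and x = x, OF rec anti])
    moreover have "\<phi> (Suc m) = (\<phi> m)(m := \<psi>' m)" and "\<phi> m = (\<phi> m)(m := \<psi> m)"
      by (auto simp: \<phi>_def fun_eq_iff less_Suc_eq)
    ultimately have "row_det l (\<phi> (Suc m)) = row_det l (\<phi> m) - c * row_det l ((\<phi> m)(m := g))"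
      using row_det_linear[of m l "\<phi> m" "\<psi> m" c g] Suc.prems by simp
    also have "row_det l ((\<phi> m)(m := g)) = 0"
    proof (cases "Suc m < l")
      case True
      then show ?thesis
        by (rule row_det_equal_rows) (simp add: \<phi>_def \<psi>_def g_def algebra_simps)
    next
      case False
      with Suc.prems have l: "l = Suc m"
        by simp
      show ?thesis
        unfolding l by (rule row_det_last_row) (use \<open>a l = 0\<close> in \<open>simp add: l g_def neg\<close>)
    qed
    finally show ?case
      using Suc by simp
  qed
  from this[of l] have "row_det l (\<phi> l) = row_det l \<psi>"
    by simp
  moreover have "row_det l (\<phi> l) = row_det l \<psi>'"
    by (rule row_det_cong) (simp add: \<phi>_def)
  ultimately show ?thesis
    by (simp add: \<psi>_def \<psi>'_def)
qed

section \<open>Horizontal strips and interlacing\<close>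

lemma is_partition_nonneg: "is_partition \<alpha> \<Longrightarrow> 0 \<le> Poly_Mapping.lookup \<alpha> i"
  by (simp add: is_partition_def)

lemma is_partition_antimono:
  "is_partition \<alpha> \<Longrightarrow> i \<le> j \<Longrightarrow> Poly_Mapping.lookup \<alpha> j \<le> Poly_Mapping.lookup \<alpha> i"
  by (simp add: is_partition_def)

text \<open>
  If \<open>\<mu>\<^sub>k < \<lambda>\<^sub>k\<^sub>+\<^sub>1\<close>, then column \<open>\<mu>\<^sub>k\<close> of the skew diagram has boxes in both rows \<open>k\<close> and
  \<open>k + 1\<close>. Conversely, two boxes in one column, in rows \<open>i < j\<close>, force
  \<open>\<mu>\<^sub>i < \<lambda>\<^sub>j \<le> \<lambda>\<^sub>i\<^sub>+\<^sub>1\<close>.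
\<close>

lemma horizontal_strip_iff_interlacing:
  assumes lam: "is_partition lam"
  shows "is_partition \<mu> \<and> contained \<mu> lam \<and> horizontal_strip (diagram lam - diagram \<mu>) \<longleftrightarrow>
    (\<forall>k. Poly_Mapping.lookup \<mu> k \<in> {Poly_Mapping.lookup lam (Suc k)..Poly_Mapping.lookup lam k})"
    (is "?L \<longleftrightarrow> ?R")
proof
  assume L: ?L
  show ?R
  proof
    fix k
    have "Poly_Mapping.lookup lam (Suc k) \<le> Poly_Mapping.lookup \<mu> k"
    proof (rule ccontr)
      assume less: "\<not> ?thesis"
      define j where "j = nat (Poly_Mapping.lookup \<mu> k)"
      have j: "int j = Poly_Mapping.lookup \<mu> k"
        using L by (simp add: j_def is_partition_nonneg)
      have "Poly_Mapping.lookup lam (Suc k) \<le> Poly_Mapping.lookup lam k"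
        "Poly_Mapping.lookup \<mu> (Suc k) \<le> Poly_Mapping.lookup \<mu> k"
        using lam L by (simp_all add: is_partition_antimono)
      then have "(k, j) \<in> diagram lam - diagram \<mu>" "(Suc k, j) \<in> diagram lam - diagram \<mu>"
        using less j by (auto simp: diagram_def)
      then show False
        using L unfolding horizontal_strip_def by (meson n_not_Suc_n)
    qed
    then show "Poly_Mapping.lookup \<mu> k \<in>
        {Poly_Mapping.lookup lam (Suc k)..Poly_Mapping.lookup lam k}"
      using L by (simp add: contained_def)
  qed
next
  assume R: ?R
  then have bounds: "Poly_Mapping.lookup lam (Suc k) \<le> Poly_Mapping.lookup \<mu> k"
    "Poly_Mapping.lookup \<mu> k \<le> Poly_Mapping.lookup lam k" for k
    by auto
  have "0 \<le> Poly_Mapping.lookup \<mu> k" for k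
    using order_trans[OF _ bounds(1)[of k]] lam by (simp add: is_partition_nonneg)
  moreover have "Poly_Mapping.lookup \<mu> j \<le> Poly_Mapping.lookup \<mu> i" if "i \<le> j" for i j
    using order_trans[OF bounds(2) bounds(1)] that by (rule lift_Suc_antimono_le)
  ultimately have "is_partition \<mu>"
    unfolding is_partition_def by blast
  moreover have "contained \<mu> lam"
    using bounds(2) by (simp add: contained_def)
  moreover have "horizontal_strip (diagram lam - diagram \<mu>)"
  proof -
    have False
      if "(i, j) \<in> diagram lam - diagram \<mu>" "(i', j) \<in> diagram lam - diagram \<mu>" "i < i'" for i i' j
    proof -
      have "int j < Poly_Mapping.lookup lam i'"
        using that by (simp add: diagram_def)
      also have "\<dots> \<le> Poly_Mapping.lookup lam (Suc i)"
        using lam that(3) by (simp add: is_partition_antimono)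
      also have "\<dots> \<le> Poly_Mapping.lookup \<mu> i"
        by (rule bounds(1))
      also have "\<dots> \<le> int j"
        using that(1) by (simp add: diagram_def)
      finally show False by simp
    qed
    then show ?thesis
      unfolding horizontal_strip_def by (metis nat_neq_iff)
  qed
  ultimately show ?L by blast
qed

lemma card_diagram_diff:
  assumes "is_partition \<mu>" and "contained \<mu> lam"
    and lam: "\<And>k. l \<le> k \<Longrightarrow> Poly_Mapping.lookup lam k = 0"
  shows "card (diagram lam - diagram \<mu>) =
    (\<Sum>k<l. nat (Poly_Mapping.lookup lam k - Poly_Mapping.lookup \<mu> k))"
proof -
  let ?I = "\<lambda>k. {nat (Poly_Mapping.lookup \<mu> k)..<nat (Poly_Mapping.lookup lam k)}"
  have nonneg: "0 \<le> Poly_Mapping.lookup \<mu> k" for k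
    using assms(1) by (rule is_partition_nonneg)
  have "(k, j) \<in> diagram lam - diagram \<mu> \<longleftrightarrow> (k, j) \<in> Sigma {..<l} ?I" for k j
  proof (cases "k < l")
    case True
    have "nat (Poly_Mapping.lookup \<mu> k) \<le> j \<longleftrightarrow> Poly_Mapping.lookup \<mu> k \<le> int j"
      "j < nat (Poly_Mapping.lookup lam k) \<longleftrightarrow> int j < Poly_Mapping.lookup lam k"
      by linarith+
    with True show ?thesis
      by (simp add: diagram_def not_less conj_commute)
  next
    case False
    then show ?thesis
      using lam[of k] by (simp add: diagram_def)
  qed
  then have "diagram lam - diagram \<mu> = Sigma {..<l} ?I"
    by (intro set_eqI) (metis surj_pair)
  then have "card (diagram lam - diagram \<mu>) = (\<Sum>k<l. card (?I k))"
    by (simp add: card_SigmaI)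
  also have "\<dots> = (\<Sum>k<l. nat (Poly_Mapping.lookup lam k - Poly_Mapping.lookup \<mu> k))"
  proof (rule sum.cong[OF refl])
    fix k
    show "card (?I k) = nat (Poly_Mapping.lookup lam k - Poly_Mapping.lookup \<mu> k)"
      using nonneg[of k] unfolding card_atLeastLessThan by linarith
  qed
  finally show ?thesis .
qed

text \<open>
  All parts from \<open>l\<close> on are forced to be zero, so an interlacing \<open>\<mu>\<close> is a free choice of its
  first \<open>l\<close> parts, which is the index set of the expanded product of row sums.
\<close>

lemma bij_betw_interlacing:
  fixes lam :: index
  assumes lam: "\<And>k. l \<le> k \<Longrightarrow> Poly_Mapping.lookup lam k = 0"
  defines "B \<equiv> \<lambda>k. {Poly_Mapping.lookup lam (Suc k)..Poly_Mapping.lookup lam k}"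
  shows "bij_betw (\<lambda>\<mu>. restrict (Poly_Mapping.lookup \<mu>) {..<l})
    {\<mu>. \<forall>k. Poly_Mapping.lookup \<mu> k \<in> B k} (PiE {..<l} B)"
proof -
  define extend where "extend \<rho> = Abs_poly_mapping (\<lambda>k. if k < l then \<rho> k else (0 :: int))" for \<rho>
  have "finite {k. (if k < l then \<rho> k else (0 :: int)) \<noteq> 0}" for \<rho>
    by (rule finite_subset[of _ "{..<l}"]) (auto split: if_splits)
  then have lookup_extend: "Poly_Mapping.lookup (extend \<rho>) k = (if k < l then \<rho> k else 0)" for \<rho> k
    by (simp add: extend_def lookup_Abs_poly_mapping)
  have B0: "B k = {0}" if "l \<le> k" for k
    using that by (simp add: B_def lam)
  show ?thesis
  proof (rule bij_betwI[where g = extend])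
    show "(\<lambda>\<mu>. restrict (Poly_Mapping.lookup \<mu>) {..<l}) \<in>
        {\<mu>. \<forall>k. Poly_Mapping.lookup \<mu> k \<in> B k} \<rightarrow> PiE {..<l} B"
      by (intro funcsetI restrict_PiE_iff[THEN iffD2]) blast
    show "extend \<in> PiE {..<l} B \<rightarrow> {\<mu>. \<forall>k. Poly_Mapping.lookup \<mu> k \<in> B k}"
    proof (intro funcsetI CollectI allI)
      fix \<rho> k assume "\<rho> \<in> PiE {..<l} B"
      then have "k < l \<Longrightarrow> \<rho> k \<in> B k"
        by (rule PiE_mem) simp
      then show "Poly_Mapping.lookup (extend \<rho>) k \<in> B k"
        using B0[of k] unfolding lookup_extend by (cases "k < l") simp_all
    qed
  next
    fix \<mu> assume "\<mu> \<in> {\<mu>. \<forall>k. Poly_Mapping.lookup \<mu> k \<in> B k}"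
    then have "Poly_Mapping.lookup \<mu> k \<in> B k" for k
      by blast
    with B0 have "l \<le> k \<Longrightarrow> Poly_Mapping.lookup \<mu> k = 0" for k
      by blast
    then show "extend (restrict (Poly_Mapping.lookup \<mu>) {..<l}) = \<mu>"
      by (intro poly_mapping_eqI) (simp add: lookup_extend)
  next
    fix \<rho> assume "\<rho> \<in> PiE {..<l} B"
    then have "\<rho> k = undefined" if "\<not> k < l" for k
      using that by (auto intro: PiE_arb)
    then show "restrict (Poly_Mapping.lookup (extend \<rho>)) {..<l} = \<rho>"
      by (intro ext) (simp add: lookup_extend restrict_def)
  qed
qed

section \<open>The reduction formula\<close>

text \<open>
  The reduction formula for an arbitrary list of variables. The row operations replace row
  \<open>k\<close> by a sum over the possible values of \<open>\<mu>\<^sub>k\<close>, and multilinearity turns the product of these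
  choices into a sum over interlacing partitions.
\<close>

lemma schur_insert:
  assumes v: "v \<notin> Z" and lam: "is_partition lam"
  defines "M \<equiv> {\<mu>. is_partition \<mu> \<and> contained \<mu> lam \<and>
    horizontal_strip (diagram lam - diagram \<mu>)}"
  shows "finite M"
    and "schur (insert v Z) lam = (\<Sum>\<mu>\<in>M. mvar v ^ card (diagram lam - diagram \<mu>) * schur Z \<mu>)"
proof -
  let ?lam = "Poly_Mapping.lookup lam"
  obtain l where "\<forall>k\<in>Poly_Mapping.keys lam. k < l"
    using finite_nat_set_iff_bounded[of "Poly_Mapping.keys lam"] by auto
  then have l: "?lam k = 0" if "l \<le> k" for k
    using that by (metis in_keys_iff not_less)
  define B where "B k = {?lam (Suc k)..?lam k}" for k
  have M: "M = {\<mu>. \<forall>k. Poly_Mapping.lookup \<mu> k \<in> B k}"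
    by (simp add: M_def B_def horizontal_strip_iff_interlacing[OF lam])
  have bij: "bij_betw (\<lambda>\<mu>. restrict (Poly_Mapping.lookup \<mu>) {..<l}) M (PiE {..<l} B)"
    unfolding M B_def using l by (rule bij_betw_interlacing)
  have "finite (PiE {..<l} B)"
    by (intro finite_PiE) (simp_all add: B_def)
  with bij show "finite M"
    by (simp add: bij_betw_finite)
  have "schur (insert v Z) lam = row_det l (\<lambda>k b. hsym (insert v Z) (?lam k + b))"
    using l by (rule schur_eq_row_det)
  also have "\<dots> = row_det l (\<lambda>k b. \<Sum>r\<in>B k. mvar v ^ nat (?lam k - r) * hsym Z (r + b))"
    unfolding B_def
    by (rule row_det_row_operations)
      (use lam l in \<open>auto simp: hsym_neg is_partition_def intro: hsym_insert[OF v]\<close>)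
  also have "\<dots> = (\<Sum>\<rho>\<in>PiE {..<l} B. (\<Prod>k<l. mvar v ^ nat (?lam k - \<rho> k)) *
      row_det l (\<lambda>k b. hsym Z (\<rho> k + b)))"
    by (rule row_det_sum) (simp add: B_def)
  also have "\<dots> = (\<Sum>\<mu>\<in>M. mvar v ^ card (diagram lam - diagram \<mu>) * schur Z \<mu>)"
  proof (rule sum.reindex_bij_betw[OF bij, symmetric, THEN trans], rule sum.cong[OF refl])
    fix \<mu> assume \<mu>: "\<mu> \<in> M"
    let ?\<rho> = "restrict (Poly_Mapping.lookup \<mu>) {..<l}"
    have "Poly_Mapping.lookup \<mu> k = 0" if "l \<le> k" for k
    proof -
      have "Poly_Mapping.lookup \<mu> k \<in> B k"
        using \<mu> by (simp add: M)
      then show ?thesis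
        using that l[of k] l[of "Suc k"] by (simp add: B_def)
    qed
    then have "schur Z \<mu> = row_det l (\<lambda>k b. hsym Z (Poly_Mapping.lookup \<mu> k + b))"
      by (rule schur_eq_row_det)
    also have "\<dots> = row_det l (\<lambda>k b. hsym Z (?\<rho> k + b))"
      by (rule row_det_cong) simp
    finally have "schur Z \<mu> = row_det l (\<lambda>k b. hsym Z (?\<rho> k + b))" .
    moreover have "card (diagram lam - diagram \<mu>) = (\<Sum>k<l. nat (?lam k - Poly_Mapping.lookup \<mu> k))"
      using \<mu> l by (intro card_diagram_diff) (auto simp: M_def)
    then have "mvar v ^ card (diagram lam - diagram \<mu>) = (\<Prod>k<l. mvar v ^ nat (?lam k - ?\<rho> k))"
      by (simp add: power_sum)
    ultimately show "(\<Prod>k<l. mvar v ^ nat (?lam k - ?\<rho> k)) *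
        row_det l (\<lambda>k b. hsym Z (?\<rho> k + b)) =
        mvar v ^ card (diagram lam - diagram \<mu>) * schur Z \<mu>"
      by simp
  qed
  finally show "schur (insert v Z) lam =
    (\<Sum>\<mu>\<in>M. mvar v ^ card (diagram lam - diagram \<mu>) * schur Z \<mu>)" .
qed

theorem mainTheorem8:
  fixes n :: nat and lam :: "nat \<Rightarrow>\<^sub>0 int"
  assumes "n \<ge> 1" and "is_partition lam"
  shows "schur (xy_vars n) lam =
    Sum_any (\<lambda>p. mvar (X n) ^ p *
      (\<Sum>\<mu> | is_partition \<mu> \<and> strip_step \<mu> p lam. schur (xy_vars (n - 1)) \<mu>))"
proof -
  let ?Z = "xy_vars (n - 1)" and ?c = "\<lambda>\<mu>. card (diagram lam - diagram \<mu>)"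
  define M where "M = {\<mu>. is_partition \<mu> \<and> contained \<mu> lam \<and>
    horizontal_strip (diagram lam - diagram \<mu>)}"
  have "X n \<notin> ?Z"
    using assms(1) by (auto simp: xy_vars_def)
  note reduce = schur_insert[OF this assms(2), folded M_def]
  have strips: "{\<mu>. is_partition \<mu> \<and> strip_step \<mu> p lam} = {\<mu> \<in> M. ?c \<mu> = p}" for p
    by (auto simp: M_def strip_step_def)
  have "{1..n} = insert n {1..n - 1}"
    using assms(1) by auto
  then have "xy_vars n = insert (X n) ?Z"
    by (simp add: xy_vars_def)
  then have "schur (xy_vars n) lam = (\<Sum>\<mu>\<in>M. mvar (X n) ^ ?c \<mu> * schur ?Z \<mu>)"
    by (simp only: reduce(2))
  also have "\<dots> = (\<Sum>p\<in>?c ` M. \<Sum>\<mu>\<in>{\<mu> \<in> M. ?c \<mu> = p}. mvar (X n) ^ ?c \<mu> * schur ?Z \<mu>)"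
    by (rule sum.image_gen[OF reduce(1)])
  also have "\<dots> = (\<Sum>p\<in>?c ` M. mvar (X n) ^ p * (\<Sum>\<mu>\<in>{\<mu> \<in> M. ?c \<mu> = p}. schur ?Z \<mu>))"
    by (intro sum.cong) (simp_all add: sum_distrib_left)
  also have "\<dots> = Sum_any (\<lambda>p. mvar (X n) ^ p * (\<Sum>\<mu>\<in>{\<mu> \<in> M. ?c \<mu> = p}. schur ?Z \<mu>))"
  proof (rule Sum_any.expand_superset[symmetric])
    have "{\<mu> \<in> M. ?c \<mu> = p} = {}" if "p \<notin> ?c ` M" for p
      using that by auto
    then show "{p. mvar (X n) ^ p * (\<Sum>\<mu>\<in>{\<mu> \<in> M. ?c \<mu> = p}. schur ?Z \<mu>) \<noteq> 0} \<subseteq> ?c ` M"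
      by (metis (mono_tags, lifting) mem_Collect_eq mult_zero_right subsetI sum.empty)
  qed (simp add: reduce(1))
  finally show ?thesis
    by (simp only: strips)
qed

end
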